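(* Let $k\ge 3$ be an integer. Let $\Gamma=2.O_k$ be the bipartite double of the Odd graph $O_k$ and let $\Lambda=E(2.O_k)$ be its extended graph, both having the same vertex set $V$. Then the automorphism group of $\Lambda$ is identical to the automorphism group of $\Gamma$, i.e. $\mathrm{Aut}(\Lambda)=\mathrm{Aut}(\Gamma)$ as groups of permutations of $V$.
   Context: For $k\ge 3$, let $\Omega=\{1,\dots,2k-1\}$ and $V=\{(v,i) : v\subset\Omega,\ |v|=k-1,\ i\in\{0,1\}\}$. The graph $2.O_k$ has vertex set $V$, with $(v,i)$ and $(w,j)$ adjacent if and only if $v\cap w=\emptyset$ and $i\ne j$. The extended graph $E(2.O_k)$ has vertex set $V$, with $(v,i)$ and $(w,j)$ adjacent if and only if $i\ne j$ and either $v\cap w=\emptyset$ or $v=w$. *)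

theory Defs
  imports "HOL-Algebra.Bij" "Graph_Theory.Pair_Digraph"
begin

text \<open>
  A simple graph is a \<^locale>\<open>pair_graph\<close>: its set of arcs is a symmetric irreflexive
  relation on a finite vertex set, each undirected edge being represented by two opposite arcs.
\<close>

definition odd_graph :: "nat \<Rightarrow> nat set pair_pre_digraph" where
  "odd_graph k = (let V = {v. v \<subseteq> {1..2 * k - 1} \<and> card v = k - 1} in
     \<lparr> pverts = V, parcs = {(v, w). v \<in> V \<and> w \<in> V \<and> v \<inter> w = {}} \<rparr>)"

definition bipartite_double :: "'a pair_pre_digraph \<Rightarrow> ('a \<times> nat) pair_pre_digraph" where
  "bipartite_double G =
     \<lparr> pverts = pverts G \<times> {0, 1},
       parcs = {((v, i), (w, j)). i \<in> {0, 1} \<and> j \<in> {0, 1} \<and> (v, w) \<in> parcs G \<and> i \<noteq> j} \<rparr>"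

definition double_odd_verts :: "nat \<Rightarrow> (nat set \<times> nat) set" where
  "double_odd_verts k = {(v, i). v \<subseteq> {1..2 * k - 1} \<and> card v = k - 1 \<and> i \<in> {0, 1}}"

definition double_odd_graph :: "nat \<Rightarrow> (nat set \<times> nat) pair_pre_digraph" where
  "double_odd_graph k =
     \<lparr> pverts = double_odd_verts k,
       parcs = {((v, i), (w, j)). (v, i) \<in> double_odd_verts k \<and> (w, j) \<in> double_odd_verts k \<and>
                  v \<inter> w = {} \<and> i \<noteq> j} \<rparr>"

definition extended_double_odd_graph :: "nat \<Rightarrow> (nat set \<times> nat) pair_pre_digraph" where
  "extended_double_odd_graph k =
     \<lparr> pverts = double_odd_verts k,
       parcs = {((v, i), (w, j)). (v, i) \<in> double_odd_verts k \<and> (w, j) \<in> double_odd_verts k \<and>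
                  i \<noteq> j \<and> (v \<inter> w = {} \<or> v = w)} \<rparr>"

definition graph_auts :: "'a pair_pre_digraph \<Rightarrow> ('a \<Rightarrow> 'a) set" where
  "graph_auts G =
     {f \<in> Bij (pverts G). \<forall>u \<in> pverts G. \<forall>v \<in> pverts G.
        (f u, f v) \<in> parcs G \<longleftrightarrow> (u, v) \<in> parcs G}"

text \<open>
  \<^const>\<open>BijGroup\<close> is the symmetric group on a set. Its elements are extensional, that is,
  \<^const>\<open>undefined\<close> outside the set, so that equality of elements is equality of permutations.
\<close>

definition graph_Aut :: "'a pair_pre_digraph \<Rightarrow> ('a \<Rightarrow> 'a) monoid" where
  "graph_Aut G = BijGroup (pverts G) \<lparr> carrier := graph_auts G \<rparr>"

lemma double_odd_graph_eq: "double_odd_graph k = bipartite_double (odd_graph k)"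
  unfolding double_odd_graph_def bipartite_double_def odd_graph_def double_odd_verts_def Let_def
  by auto

lemma finite_double_odd_verts: "finite (double_odd_verts k)"
proof -
  have "double_odd_verts k \<subseteq> Pow {1..2 * k - 1} \<times> {0, 1}"
    by (auto simp: double_odd_verts_def)
  then show ?thesis
    by (rule finite_subset) simp
qed

lemma pair_graphI:
  assumes "finite (pverts G)" "parcs G \<subseteq> pverts G \<times> pverts G" "sym (parcs G)" "irrefl (parcs G)"
  shows "pair_graph G"
proof -
  have "finite (parcs G)"
    using assms(1,2) by (meson finite_SigmaI finite_subset)
  with assms show ?thesis
    by unfold_locales (auto simp: symmetric_def arcs_ends_def arc_to_ends_def irrefl_def)
qed

lemma pair_graph_double_odd: "pair_graph (double_odd_graph k)"
  by (rule pair_graphI)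
    (auto simp: double_odd_graph_def finite_double_odd_verts sym_def irrefl_def)

lemma pair_graph_extended_double_odd: "pair_graph (extended_double_odd_graph k)"
  by (rule pair_graphI)
    (auto simp: extended_double_odd_graph_def finite_double_odd_verts sym_def irrefl_def)

lemma subgroup_graph_auts: "subgroup (graph_auts G) (BijGroup (pverts G))"
proof (rule group.subgroupI[OF group_BijGroup])
  show "graph_auts G \<subseteq> carrier (BijGroup (pverts G))"
    by (auto simp: graph_auts_def BijGroup_def)
  have "(\<lambda>x \<in> pverts G. x) \<in> graph_auts G"
    by (auto simp: graph_auts_def id_Bij)
  then show "graph_auts G \<noteq> {}"
    by blast
next
  fix f assume f: "f \<in> graph_auts G"
  then have B: "f \<in> Bij (pverts G)"
    by (simp add: graph_auts_def)
  then have b: "bij_betw f (pverts G) (pverts G)"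
    by (simp add: Bij_def)
  let ?g = "inv_into (pverts G) f"
  have g: "?g x \<in> pverts G" "f (?g x) = x" if "x \<in> pverts G" for x
    using b that by (auto simp: bij_betw_def inv_into_into f_inv_into_f)
  have "(?g u, ?g v) \<in> parcs G \<longleftrightarrow> (u, v) \<in> parcs G" if "u \<in> pverts G" "v \<in> pverts G" for u v
    using f g[OF that(1)] g[OF that(2)] unfolding graph_auts_def by fastforce
  then show "inv\<^bsub>BijGroup (pverts G)\<^esub> f \<in> graph_auts G"
    using B by (simp add: inv_BijGroup graph_auts_def restrict_inv_into_Bij)
next
  fix f h assume fh: "f \<in> graph_auts G" "h \<in> graph_auts G"
  then have B: "f \<in> Bij (pverts G)" "h \<in> Bij (pverts G)"
    by (simp_all add: graph_auts_def)
  have "h x \<in> pverts G" if "x \<in> pverts G" for x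
    using B(2) that by (auto dest: Bij_imp_funcset)
  then show "f \<otimes>\<^bsub>BijGroup (pverts G)\<^esub> h \<in> graph_auts G"
    using fh B by (auto simp: BijGroup_def graph_auts_def compose_Bij compose_eq)
qed

lemma group_graph_Aut: "group (graph_Aut G)"
  unfolding graph_Aut_def
  by (rule subgroup.subgroup_is_group[OF subgroup_graph_auts group_BijGroup])

end

theory Submission
  imports Defs
begin

text \<open>
  The arcs of the extended graph are those of the double Odd graph together with the pairs joining
  \<open>(v, 0)\<close> and \<open>(v, 1)\<close>, which form a perfect matching. Both inclusions between the automorphism
  groups follow once this matching is recovered, without reference to labels, from each of the two
  graphs alone.

  In the double Odd graph, replacing \<open>(v, 1)\<close> by the complement of \<open>v\<close> gives the inclusion graph of
  the two middle layers of the Boolean lattice, where the matching joins disjoint sets. These are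
  the pairs at maximal distance \<open>2 * k - 1\<close>: the walks of a given length are described in
  \<open>double_odd_walks\<close>, and \<open>matching_eq_walks\<close> reads off the matching.

  In the extended graph, the matching edges over two adjacent vertices of the Odd graph lie in a
  common 4-cycle, so the matching edge over \<open>v\<close> lies in one 4-cycle for each of the \<open>k\<close>
  neighbours of \<open>v\<close> in the Odd graph. Since the Odd graph has neither
  triangles nor 4-cycles, every other edge lies in only one such cycle. The matching therefore
  consists of the edges lying in at least two 4-cycles (\<open>matching_eq_two_squares\<close>).
\<close>

section \<open>Relations invariant under automorphisms\<close>

lemma graph_auts_in_verts:
  assumes "f \<in> graph_auts G" "x \<in> pverts G"
  shows "f x \<in> pverts G"
  using assms by (auto simp: graph_auts_def dest: Bij_imp_funcset)

lemma graph_auts_arc_iff: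
  assumes "f \<in> graph_auts G" "x \<in> pverts G" "y \<in> pverts G"
  shows "(f x, f y) \<in> parcs G \<longleftrightarrow> (x, y) \<in> parcs G"
  using assms by (auto simp: graph_auts_def)

lemma graph_auts_eq_iff:
  assumes "f \<in> graph_auts G" "x \<in> pverts G" "y \<in> pverts G"
  shows "f x = f y \<longleftrightarrow> x = y"
  using assms by (auto simp: graph_auts_def Bij_def bij_betw_def inj_on_eq_iff)

text \<open>
  Automorphisms form a group, so a relation that all of them preserve is also reflected by each of
  them: the reverse implication comes from the inverse.
\<close>

lemma graph_auts_reflect:
  assumes f: "f \<in> graph_auts G"
    and pres: "\<And>g x y. g \<in> graph_auts G \<Longrightarrow> x \<in> pverts G \<Longrightarrow> y \<in> pverts G \<Longrightarrow> P x y \<Longrightarrow> P (g x) (g y)"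
    and xy: "x \<in> pverts G" "y \<in> pverts G"
  shows "P (f x) (f y) \<longleftrightarrow> P x y"
proof
  assume P: "P (f x) (f y)"
  let ?g = "inv\<^bsub>BijGroup (pverts G)\<^esub> f"
  have B: "f \<in> Bij (pverts G)"
    using f by (simp add: graph_auts_def)
  have g: "?g \<in> graph_auts G"
    by (rule subgroup.m_inv_closed[OF subgroup_graph_auts f])
  have gf: "?g (f z) = z" if "z \<in> pverts G" for z
    using B that graph_auts_in_verts[OF f that]
    by (simp add: inv_BijGroup Bij_def bij_betw_def inv_into_f_f)
  have "P (?g (f x)) (?g (f y))"
    by (rule pres[OF g graph_auts_in_verts[OF f xy(1)] graph_auts_in_verts[OF f xy(2)] P])
  then show "P x y"
    by (simp add: gf xy)
qed (rule pres[OF f xy])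

lemma graph_auts_walk:
  assumes f: "f \<in> graph_auts G" and G: "parcs G \<subseteq> pverts G \<times> pverts G"
    and x: "x \<in> pverts G" and walk: "(x, y) \<in> parcs G ^^ n"
  shows "(f x, f y) \<in> parcs G ^^ n"
  using walk
proof (induction n arbitrary: y)
  case (Suc n)
  then obtain z where z: "(x, z) \<in> parcs G ^^ n" "(z, y) \<in> parcs G"
    by auto
  then have "(f z, f y) \<in> parcs G"
    using graph_auts_arc_iff[OF f] G by blast
  with Suc.IH[OF z(1)] show ?case
    by auto
qed simp

text \<open>
  Two 4-cycles \<open>x, y, p, q\<close> and \<open>x, y, p', q'\<close> through an edge are required to differ in the vertex
  next to \<open>y\<close>. This is the form in which the cycles through the edges to be distinguished differ.
\<close>

definition two_squares :: "'a pair_pre_digraph \<Rightarrow> 'a \<Rightarrow> 'a \<Rightarrow> bool" where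
  "two_squares G x y \<longleftrightarrow> (x, y) \<in> parcs G \<and>
     (\<exists>p \<in> pverts G. \<exists>q \<in> pverts G. \<exists>p' \<in> pverts G. \<exists>q' \<in> pverts G. p \<noteq> p' \<and>
        p \<noteq> x \<and> q \<noteq> y \<and> (y, p) \<in> parcs G \<and> (p, q) \<in> parcs G \<and> (q, x) \<in> parcs G \<and>
        p' \<noteq> x \<and> q' \<noteq> y \<and> (y, p') \<in> parcs G \<and> (p', q') \<in> parcs G \<and> (q', x) \<in> parcs G)"

lemma graph_auts_two_squares:
  assumes f: "f \<in> graph_auts G" and xy: "x \<in> pverts G" "y \<in> pverts G"
    and sq: "two_squares G x y"
  shows "two_squares G (f x) (f y)"
proof -
  obtain p q p' q' where V: "p \<in> pverts G" "q \<in> pverts G" "p' \<in> pverts G" "q' \<in> pverts G"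
    and ne: "p \<noteq> p'" "p \<noteq> x" "q \<noteq> y" "p' \<noteq> x" "q' \<noteq> y"
    and arc: "(x, y) \<in> parcs G" "(y, p) \<in> parcs G" "(p, q) \<in> parcs G" "(q, x) \<in> parcs G"
      "(y, p') \<in> parcs G" "(p', q') \<in> parcs G" "(q', x) \<in> parcs G"
    using sq unfolding two_squares_def by blast
  note arc_iff = graph_auts_arc_iff[OF f] and eq_iff = graph_auts_eq_iff[OF f]
  have "f p \<in> pverts G" "f q \<in> pverts G" "f p' \<in> pverts G" "f q' \<in> pverts G"
    using V by (simp_all add: graph_auts_in_verts[OF f])
  moreover have "f p \<noteq> f p'" "f p \<noteq> f x" "f q \<noteq> f y" "f p' \<noteq> f x" "f q' \<noteq> f y"
    using V ne xy by (simp_all add: eq_iff)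
  moreover have "(f x, f y) \<in> parcs G" "(f y, f p) \<in> parcs G" "(f p, f q) \<in> parcs G"
    "(f q, f x) \<in> parcs G" "(f y, f p') \<in> parcs G" "(f p', f q') \<in> parcs G"
    "(f q', f x) \<in> parcs G"
    using V arc xy by (simp_all add: arc_iff)
  ultimately show ?thesis
    unfolding two_squares_def by blast
qed

section \<open>Subsets of almost half the size\<close>

definition odd_sets :: "nat \<Rightarrow> nat set set" where
  "odd_sets k = {v. v \<subseteq> {1..2 * k - 1} \<and> card v = k - 1}"

lemma odd_setsD:
  assumes "v \<in> odd_sets k"
  shows "finite v" "v \<subseteq> {1..2 * k - 1}" "card v = k - 1"
  using assms by (auto simp: odd_sets_def intro: finite_subset)

lemma card_compl_odd_set:
  assumes "k \<ge> 1" "v \<in> odd_sets k"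
  shows "card ({1..2 * k - 1} - v) = k"
  using assms odd_setsD[OF assms(2)] by (simp add: card_Diff_subset)

lemma odd_sets_remove:
  assumes "k \<ge> 1" "v \<in> odd_sets k" "a \<in> {1..2 * k - 1} - v"
  shows "{1..2 * k - 1} - v - {a} \<in> odd_sets k"
  using assms card_compl_odd_set[OF assms(1,2)] by (auto simp: odd_sets_def)

lemma odd_sets_eqI:
  assumes "v \<in> odd_sets k" "w \<in> odd_sets k" "v \<subseteq> w"
  shows "v = w"
  using assms by (metis odd_setsD(1,3) card_subset_eq)

lemma odd_sets_disjoint_neq:
  assumes "k \<ge> 2" "v \<in> odd_sets k" "v \<inter> w = {}"
  shows "v \<noteq> w"
  using assms odd_setsD(3)[OF assms(2)] by auto

lemma odd_sets_two_disjoint: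
  assumes "k \<ge> 2" "v \<in> odd_sets k"
  obtains w w' where "w \<in> odd_sets k" "w' \<in> odd_sets k" "w \<noteq> w'" "v \<inter> w = {}" "v \<inter> w' = {}"
proof -
  have "\<not> card ({1..2 * k - 1} - v) \<le> Suc 0"
    using card_compl_odd_set[of k v] assms by simp
  moreover have "finite ({1..2 * k - 1} - v)"
    by simp
  ultimately obtain a b where ab: "a \<noteq> b" "a \<in> {1..2 * k - 1} - v" "b \<in> {1..2 * k - 1} - v"
    using card_le_Suc0_iff_eq by metis
  show thesis
  proof (rule that)
    show "{1..2 * k - 1} - v - {a} \<in> odd_sets k" "{1..2 * k - 1} - v - {b} \<in> odd_sets k"
      using odd_sets_remove[OF _ assms(2) ab(2)] odd_sets_remove[OF _ assms(2) ab(3)] assms(1)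
      by linarith+
    show "{1..2 * k - 1} - v - {a} \<noteq> {1..2 * k - 1} - v - {b}"
      using ab by blast
  qed blast+
qed

text \<open>
  Two distinct sets disjoint from \<open>w\<close> already cover the complement of \<open>w\<close>, which has only one
  element more than each of them.
\<close>

lemma odd_sets_Un:
  assumes "k \<ge> 1" "u \<in> odd_sets k" "v \<in> odd_sets k" "w \<in> odd_sets k"
    and "u \<noteq> v" "u \<inter> w = {}" "v \<inter> w = {}"
  shows "u \<union> v = {1..2 * k - 1} - w"
proof (rule card_seteq)
  have "u \<subset> u \<union> v"
    using odd_sets_eqI[OF assms(3,2)] assms(5) by blast
  then have "card u < card (u \<union> v)"
    using assms(2,3) by (intro psubset_card_mono) (auto dest: odd_setsD(1))
  then show "card ({1..2 * k - 1} - w) \<le> card (u \<union> v)"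
    using card_compl_odd_set[OF assms(1,4)] odd_setsD(3)[OF assms(2)] by simp
  show "u \<union> v \<subseteq> {1..2 * k - 1} - w"
    using odd_setsD(2)[OF assms(2)] odd_setsD(2)[OF assms(3)] assms(6,7) by blast
qed simp

lemma odd_sets_no_triangle:
  assumes "k \<ge> 3" "u \<in> odd_sets k" "v \<in> odd_sets k" "w \<in> odd_sets k"
    and "u \<inter> v = {}" "u \<inter> w = {}" "v \<inter> w = {}"
  shows False
proof -
  have "card (u \<union> v) = k"
    using odd_sets_Un[of k u v w] odd_sets_disjoint_neq[of k u v] card_compl_odd_set[of k w] assms
    by auto
  moreover have "card (u \<union> v) = (k - 1) + (k - 1)"
    using assms(2,3,5) by (simp add: card_Un_disjoint odd_setsD)
  ultimately show False
    using assms(1) by simp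
qed

lemma odd_sets_no_square:
  assumes "k \<ge> 1" "t \<in> odd_sets k" "u \<in> odd_sets k" "v \<in> odd_sets k" "w \<in> odd_sets k"
    and "u \<noteq> v" "u \<inter> w = {}" "v \<inter> w = {}" "u \<inter> t = {}" "v \<inter> t = {}"
  shows "t = w"
proof (rule odd_sets_eqI[OF assms(2,5)])
  show "t \<subseteq> w"
    using odd_sets_Un[OF assms(1,3,4,5,6,7,8)] odd_setsD(2)[OF assms(2)] assms(9,10) by blast
qed

section \<open>Walks in the double Odd graph\<close>

text \<open>
  A neighbour \<open>u\<close> of \<open>w\<close> that is as close as possible to \<open>v\<close> contains \<open>v - w\<close>; this is possible
  because \<open>v - w\<close> has at most \<open>k - 1\<close> elements.
\<close>

lemma ex_disjoint_card_diff_le_iff: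
  assumes "k \<ge> 1" "v \<in> odd_sets k" "w \<in> odd_sets k"
  shows "(\<exists>u \<in> odd_sets k. u \<inter> w = {} \<and> card (v - u) \<le> m) \<longleftrightarrow> card (v \<inter> w) \<le> m"
proof
  assume "\<exists>u \<in> odd_sets k. u \<inter> w = {} \<and> card (v - u) \<le> m"
  then obtain u where u: "u \<inter> w = {}" "card (v - u) \<le> m"
    by blast
  have "card (v \<inter> w) \<le> card (v - u)"
    using u(1) odd_setsD(1)[OF assms(2)] by (intro card_mono) auto
  then show "card (v \<inter> w) \<le> m"
    using u(2) by simp
next
  assume m: "card (v \<inter> w) \<le> m"
  have "card (v - w) \<le> k - 1"
    using odd_setsD[OF assms(2)] by (metis card_mono Diff_subset)
  then obtain u where u: "v - w \<subseteq> u" "u \<subseteq> {1..2 * k - 1} - w" "card u = k - 1"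
    using exists_subset_between[of "v - w" "k - 1" "{1..2 * k - 1} - w"]
      card_compl_odd_set[OF assms(1,3)] odd_setsD(2)[OF assms(2)] by auto
  have "card (v - u) \<le> card (v \<inter> w)"
    using u(1) odd_setsD(1)[OF assms(2)] by (intro card_mono) auto
  moreover have "u \<in> odd_sets k"
    using u by (auto simp: odd_sets_def)
  ultimately show "\<exists>u \<in> odd_sets k. u \<inter> w = {} \<and> card (v - u) \<le> m"
    using m u(2) by (intro bexI[of _ u]) auto
qed

text \<open>
  A neighbour \<open>u\<close> of \<open>w\<close> is the complement of \<open>w\<close> with one element removed. Choosing that element in
  \<open>v - w\<close> reduces the intersection of \<open>v\<close> with the complement of \<open>w\<close> by one, and no choice does
  better.
\<close>

lemma ex_disjoint_card_inter_le_iff: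
  assumes "k \<ge> 1" "v \<in> odd_sets k" "w \<in> odd_sets k"
  shows "(\<exists>u \<in> odd_sets k. u \<inter> w = {} \<and> card (v \<inter> u) \<le> m) \<longleftrightarrow> card (v - w) \<le> Suc m"
proof
  assume "\<exists>u \<in> odd_sets k. u \<inter> w = {} \<and> card (v \<inter> u) \<le> m"
  then obtain u where u: "u \<in> odd_sets k" "u \<inter> w = {}" "card (v \<inter> u) \<le> m"
    by blast
  let ?R = "{1..2 * k - 1} - w - u"
  have "u \<subseteq> {1..2 * k - 1} - w"
    using odd_setsD(2)[OF u(1)] u(2) by auto
  then have "card ?R = k - (k - 1)"
    using odd_setsD[OF u(1)] card_compl_odd_set[OF assms(1,3)]
    by (metis card_Diff_subset)
  then have R: "card ?R = 1"
    using assms(1) by simp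
  have "card (v - w) \<le> card ((v \<inter> u) \<union> ?R)"
    using odd_setsD[OF assms(2)] by (intro card_mono) auto
  also have "\<dots> \<le> card (v \<inter> u) + card ?R"
    by (rule card_Un_le)
  finally show "card (v - w) \<le> Suc m"
    using u(3) R by simp
next
  assume m: "card (v - w) \<le> Suc m"
  have "{1..2 * k - 1} - w \<noteq> {}"
    using card_compl_odd_set[OF assms(1,3)] assms(1) by (metis card.empty not_one_le_zero)
  then obtain a where a: "a \<in> {1..2 * k - 1} - w" "v - w \<noteq> {} \<Longrightarrow> a \<in> v - w"
    using odd_setsD(2)[OF assms(2)] by blast
  let ?u = "{1..2 * k - 1} - w - {a}"
  have "v \<inter> ?u = v - w - {a}"
    using odd_setsD(2)[OF assms(2)] by auto
  then have "card (v \<inter> ?u) \<le> m"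
    using m a(2) odd_setsD(1)[OF assms(2)] by (cases "v - w = {}") auto
  then show "\<exists>u \<in> odd_sets k. u \<inter> w = {} \<and> card (v \<inter> u) \<le> m"
    using odd_sets_remove[OF assms(1,3) a(1)] by (intro bexI[of _ ?u]) auto
qed

lemma double_odd_verts_iff: "(v, i) \<in> double_odd_verts k \<longleftrightarrow> v \<in> odd_sets k \<and> i \<in> {0, 1}"
  by (auto simp: double_odd_verts_def odd_sets_def)

lemma double_odd_arc_iff:
  "((v, i), (w, j)) \<in> parcs (double_odd_graph k) \<longleftrightarrow>
     v \<in> odd_sets k \<and> w \<in> odd_sets k \<and> i \<in> {0, 1} \<and> j \<in> {0, 1} \<and> v \<inter> w = {} \<and> i \<noteq> j"
  by (auto simp: double_odd_graph_def double_odd_verts_iff)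

text \<open>
  A walk of even length stays on its side and exchanges at most one element every two steps. One
  further step passes to the complement, up to one element, which turns set differences into
  intersections. The two statements are proved together, each parity from the previous one.
\<close>

lemma double_odd_walks:
  assumes "k \<ge> 1" "v \<in> odd_sets k" "w \<in> odd_sets k" "i \<in> {0, 1}" "j \<in> {0, 1}"
  shows "((v, i), (w, j)) \<in> parcs (double_odd_graph k) ^^ (2 * m) \<longleftrightarrow> i = j \<and> card (v - w) \<le> m"
    and "((v, i), (w, j)) \<in> parcs (double_odd_graph k) ^^ Suc (2 * m) \<longleftrightarrow>
           i \<noteq> j \<and> card (v \<inter> w) \<le> m"
proof -
  let ?E = "parcs (double_odd_graph k)"
  let ?even = "\<lambda>m. \<forall>w \<in> odd_sets k. \<forall>j \<in> {0, 1}.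
    ((v, i), (w, j)) \<in> ?E ^^ (2 * m) \<longleftrightarrow> i = j \<and> card (v - w) \<le> m"
  let ?odd = "\<lambda>m. \<forall>w \<in> odd_sets k. \<forall>j \<in> {0, 1}.
    ((v, i), (w, j)) \<in> ?E ^^ Suc (2 * m) \<longleftrightarrow> i \<noteq> j \<and> card (v \<inter> w) \<le> m"
  \<comment> \<open>The last step of a walk flips the second component, so it comes from \<open>(u, 1 - j)\<close>.\<close>
  have last: "((v, i), (w, j)) \<in> ?E ^^ Suc n \<longleftrightarrow>
      (\<exists>u \<in> odd_sets k. u \<inter> w = {} \<and> ((v, i), (u, 1 - j)) \<in> ?E ^^ n)"
    if "w \<in> odd_sets k" "j \<in> {0, 1}" for w j n
  proof -
    have "((u, l), (w, j)) \<in> ?E \<longleftrightarrow> u \<in> odd_sets k \<and> u \<inter> w = {} \<and> l = 1 - j" for u l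
      using that by (auto simp: double_odd_arc_iff)
    then show ?thesis
      by (auto simp: relcomp_unfold)
  qed
  have flip: "i = 1 - j \<longleftrightarrow> i \<noteq> j" "1 - j \<in> {0, 1}" if "j \<in> {0, 1}" for j
    using that assms(4) by auto
  have odd: "?odd m" if "?even m" for m
  proof (intro ballI)
    fix w j assume w: "w \<in> odd_sets k" and j: "j \<in> {0, 1::nat}"
    have "((v, i), (w, j)) \<in> ?E ^^ Suc (2 * m) \<longleftrightarrow>
        (\<exists>u \<in> odd_sets k. u \<inter> w = {} \<and> i = 1 - j \<and> card (v - u) \<le> m)"
      unfolding last[OF w j] using that flip(2)[OF j] by blast
    also have "\<dots> \<longleftrightarrow> i \<noteq> j \<and> card (v \<inter> w) \<le> m"
      using ex_disjoint_card_diff_le_iff[OF assms(1,2) w, of m] flip[OF j] by blast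
    finally show "((v, i), (w, j)) \<in> ?E ^^ Suc (2 * m) \<longleftrightarrow> i \<noteq> j \<and> card (v \<inter> w) \<le> m" .
  qed
  have even: "?even (Suc m)" if "?odd m" for m
  proof (intro ballI)
    fix w j assume w: "w \<in> odd_sets k" and j: "j \<in> {0, 1::nat}"
    have "((v, i), (w, j)) \<in> ?E ^^ Suc (Suc (2 * m)) \<longleftrightarrow>
        (\<exists>u \<in> odd_sets k. u \<inter> w = {} \<and> i \<noteq> 1 - j \<and> card (v \<inter> u) \<le> m)"
      unfolding last[OF w j] using that flip(2)[OF j] by blast
    also have "\<dots> \<longleftrightarrow> i = j \<and> card (v - w) \<le> Suc m"
      using ex_disjoint_card_inter_le_iff[OF assms(1,2) w, of m] flip[OF j] by blast
    finally show "((v, i), (w, j)) \<in> ?E ^^ (2 * Suc m) \<longleftrightarrow> i = j \<and> card (v - w) \<le> Suc m"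
      by simp
  qed
  have ev: "?even m" for m
  proof (induction m)
    case 0
    show ?case
      using odd_sets_eqI[OF assms(2)] odd_setsD(1)[OF assms(2)] by auto
  next
    case (Suc m)
    show ?case
      by (rule even[OF odd[OF Suc]])
  qed
  show "((v, i), (w, j)) \<in> ?E ^^ (2 * m) \<longleftrightarrow> i = j \<and> card (v - w) \<le> m"
    by (rule bspec[OF bspec[OF ev assms(3)] assms(5)])
  show "((v, i), (w, j)) \<in> ?E ^^ Suc (2 * m) \<longleftrightarrow> i \<noteq> j \<and> card (v \<inter> w) \<le> m"
    by (rule bspec[OF bspec[OF odd[OF ev] assms(3)] assms(5)])
qed

section \<open>Recovering the matching from either graph\<close>

definition matched :: "nat set \<times> nat \<Rightarrow> nat set \<times> nat \<Rightarrow> bool" where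
  "matched x y \<longleftrightarrow> fst x = fst y \<and> snd x \<noteq> snd y"

lemma double_odd_arc_verts:
  "parcs (double_odd_graph k) \<subseteq> pverts (double_odd_graph k) \<times> pverts (double_odd_graph k)"
  by (auto simp: double_odd_graph_def)

lemma pverts_double_odd [simp]:
  "pverts (double_odd_graph k) = double_odd_verts k"
  "pverts (extended_double_odd_graph k) = double_odd_verts k"
  by (simp_all add: double_odd_graph_def extended_double_odd_graph_def)

lemma extended_arc_iff:
  "((v, i), (w, j)) \<in> parcs (extended_double_odd_graph k) \<longleftrightarrow>
     v \<in> odd_sets k \<and> w \<in> odd_sets k \<and> i \<in> {0, 1} \<and> j \<in> {0, 1} \<and> i \<noteq> j \<and>
     (v \<inter> w = {} \<or> v = w)"
  by (auto simp: extended_double_odd_graph_def double_odd_verts_iff)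

lemma extended_arc_eq:
  assumes "x \<in> double_odd_verts k" "y \<in> double_odd_verts k"
  shows "(x, y) \<in> parcs (extended_double_odd_graph k) \<longleftrightarrow>
    (x, y) \<in> parcs (double_odd_graph k) \<or> matched x y"
  using assms
  by (cases x, cases y) (auto simp: extended_arc_iff double_odd_arc_iff double_odd_verts_iff matched_def)

lemma double_odd_arc_not_matched:
  assumes "k \<ge> 2" "(x, y) \<in> parcs (double_odd_graph k)"
  shows "\<not> matched x y"
  using assms odd_sets_disjoint_neq[OF assms(1)]
  by (cases x, cases y) (auto simp: double_odd_arc_iff matched_def)

text \<open>
  Intersections of two \<open>(k - 1)\<close>-sets have at most \<open>k - 1\<close> elements, with equality only for equal
  sets; so between the two sides all distances are at most \<open>2 * k - 1\<close>, and matched vertices are the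
  ones where the distance exceeds \<open>2 * k - 3\<close>.
\<close>

lemma matching_eq_walks:
  assumes "k \<ge> 2" "x \<in> double_odd_verts k" "y \<in> double_odd_verts k"
  shows "matched x y \<longleftrightarrow> (x, y) \<in> parcs (double_odd_graph k) ^^ Suc (2 * (k - 1)) \<and>
    (x, y) \<notin> parcs (double_odd_graph k) ^^ Suc (2 * (k - 2))"
proof -
  obtain v i w j where xy: "x = (v, i)" "y = (w, j)"
    by (cases x, cases y)
  have V: "v \<in> odd_sets k" "w \<in> odd_sets k" "i \<in> {0, 1}" "j \<in> {0, 1}"
    using assms(2,3) by (simp_all add: xy double_odd_verts_iff)
  have fin: "finite v" and card: "card v = k - 1"
    using odd_setsD[OF V(1)] by auto
  have le: "card (v \<inter> w) \<le> k - 1"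
    using fin card by (metis card_mono inf_le1)
  have "card (v \<inter> w) \<le> k - 2 \<longleftrightarrow> v \<noteq> w"
  proof
    assume "v \<noteq> w"
    then have "v \<inter> w \<subset> v"
      using odd_sets_eqI[OF V(1,2)] by blast
    then have "card (v \<inter> w) < k - 1"
      using psubset_card_mono[OF fin] card by metis
    then show "card (v \<inter> w) \<le> k - 2"
      by simp
  qed (use card assms(1) in auto)
  with le show ?thesis
    using double_odd_walks(2)[of k v w i j] V assms(1)
    by (auto simp: xy matched_def simp del: relpow.simps)
qed

text \<open>
  Through the edge joining \<open>(v, i)\<close> and \<open>(w, j)\<close>, where \<open>v\<close> and \<open>w\<close> are disjoint, the only 4-cycle is
  the one that uses the matching edges at both ends; any other would project to a triangle or a
  4-cycle of the Odd graph.
\<close>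

lemma extended_square_unique:
  assumes k: "k \<ge> 3" and disj: "v \<inter> w = {}"
    and arcs: "((v, i), (w, j)) \<in> parcs (extended_double_odd_graph k)"
      "((w, j), p) \<in> parcs (extended_double_odd_graph k)"
      "(p, q) \<in> parcs (extended_double_odd_graph k)"
      "(q, (v, i)) \<in> parcs (extended_double_odd_graph k)"
    and ne: "p \<noteq> (v, i)" "q \<noteq> (w, j)"
  shows "p = (w, i)"
proof -
  obtain u i' t j' where pq: "p = (u, i')" "q = (t, j')"
    by (cases p, cases q)
  have V: "u \<in> odd_sets k" "t \<in> odd_sets k" "v \<in> odd_sets k" "w \<in> odd_sets k"
    and i': "i' = i" and j': "j' = j"
    and adj: "w \<inter> u = {} \<or> w = u" "u \<inter> t = {} \<or> u = t" "t \<inter> v = {} \<or> t = v"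
    using arcs by (auto simp: pq extended_arc_iff)
  have ne': "u \<noteq> v" "t \<noteq> w"
    using ne by (auto simp: pq i' j')
  have "w = u"
  proof (rule ccontr)
    assume "w \<noteq> u"
    then have wu: "u \<inter> w = {}"
      using adj(1) by blast
    then have uv: "u \<inter> v \<noteq> {}"
      using odd_sets_no_triangle[OF k V(1,3,4)] disj by blast
    then have "u \<inter> t = {}" "v \<inter> t = {}"
      using adj(2,3) ne' by blast+
    then show False
      using odd_sets_no_square[of k t u v w] V k ne' wu disj by auto
  qed
  then show ?thesis
    by (simp add: pq i')
qed

lemma matching_eq_two_squares:
  assumes "k \<ge> 3" "x \<in> double_odd_verts k" "y \<in> double_odd_verts k"
  shows "matched x y \<longleftrightarrow> two_squares (extended_double_odd_graph k) x y"
proof -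
  obtain v i w j where xy: "x = (v, i)" "y = (w, j)"
    by (cases x, cases y)
  have V: "v \<in> odd_sets k" "w \<in> odd_sets k" "i \<in> {0, 1}" "j \<in> {0, 1}"
    using assms(2,3) by (simp_all add: xy double_odd_verts_iff)
  show ?thesis
  proof
    assume "matched x y"
    then have wv: "w = v" and ij: "i \<noteq> j"
      by (auto simp: matched_def xy)
    obtain u u' where u: "u \<in> odd_sets k" "u' \<in> odd_sets k" "u \<noteq> u'" "v \<inter> u = {}" "v \<inter> u' = {}"
      using odd_sets_two_disjoint[of k v] V(1) assms(1) by auto
    have "v \<noteq> u" "v \<noteq> u'"
      using odd_sets_disjoint_neq[of k v] V(1) u(4,5) assms(1) by auto
    then have ne: "(u, i) \<noteq> (u', i)" "(u, i) \<noteq> (v, i)" "(u, j) \<noteq> (v, j)"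
        "(u', i) \<noteq> (v, i)" "(u', j) \<noteq> (v, j)"
      using u(3) by auto
    have verts: "(u, i) \<in> double_odd_verts k" "(u, j) \<in> double_odd_verts k"
        "(u', i) \<in> double_odd_verts k" "(u', j) \<in> double_odd_verts k"
      using u V by (simp_all add: double_odd_verts_iff)
    have square: "((v, j), (z, i)) \<in> parcs (extended_double_odd_graph k)"
        "((z, i), (z, j)) \<in> parcs (extended_double_odd_graph k)"
        "((z, j), (v, i)) \<in> parcs (extended_double_odd_graph k)"
      if "z \<in> odd_sets k" "v \<inter> z = {}" for z
      using that V ij by (auto simp: extended_arc_iff)
    have "((v, i), (v, j)) \<in> parcs (extended_double_odd_graph k)"
      using V ij by (simp add: extended_arc_iff)
    then show "two_squares (extended_double_odd_graph k) x y"
      unfolding two_squares_def xy wv pverts_double_odd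
      using ne verts square[OF u(1,4)] square[OF u(2,5)] by meson
  next
    assume "two_squares (extended_double_odd_graph k) x y"
    then obtain p q p' q' where
        arc: "((v, i), (w, j)) \<in> parcs (extended_double_odd_graph k)"
      and p: "((w, j), p) \<in> parcs (extended_double_odd_graph k)"
        "(p, q) \<in> parcs (extended_double_odd_graph k)"
        "(q, (v, i)) \<in> parcs (extended_double_odd_graph k)" "p \<noteq> (v, i)" "q \<noteq> (w, j)"
      and p': "((w, j), p') \<in> parcs (extended_double_odd_graph k)"
        "(p', q') \<in> parcs (extended_double_odd_graph k)"
        "(q', (v, i)) \<in> parcs (extended_double_odd_graph k)" "p' \<noteq> (v, i)" "q' \<noteq> (w, j)"
      and "p \<noteq> p'"
      unfolding two_squares_def xy by blast
    then have "v \<inter> w \<noteq> {}"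
      using extended_square_unique[OF assms(1) _ arc p]
        extended_square_unique[OF assms(1) _ arc p'] by auto
    then show "matched x y"
      using arc by (auto simp: matched_def xy extended_arc_iff)
  qed
qed

section \<open>Equality of the automorphism groups\<close>

lemma double_odd_auts_matched:
  assumes "k \<ge> 2" "f \<in> graph_auts (double_odd_graph k)"
    and xy: "x \<in> double_odd_verts k" "y \<in> double_odd_verts k"
  shows "matched (f x) (f y) \<longleftrightarrow> matched x y"
proof -
  let ?G = "double_odd_graph k"
  have "(f x, f y) \<in> parcs ?G ^^ n \<longleftrightarrow> (x, y) \<in> parcs ?G ^^ n" for n
    by (rule graph_auts_reflect[OF assms(2)])
      (use graph_auts_walk[OF _ double_odd_arc_verts] xy in auto)
  moreover have "f x \<in> double_odd_verts k" "f y \<in> double_odd_verts k"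
    using graph_auts_in_verts[OF assms(2)] xy by simp_all
  ultimately show ?thesis
    using matching_eq_walks[OF assms(1)] xy by (simp del: relpow.simps)
qed

lemma extended_auts_matched:
  assumes "k \<ge> 3" "f \<in> graph_auts (extended_double_odd_graph k)"
    and xy: "x \<in> double_odd_verts k" "y \<in> double_odd_verts k"
  shows "matched (f x) (f y) \<longleftrightarrow> matched x y"
proof -
  let ?G = "extended_double_odd_graph k"
  have "two_squares ?G (f x) (f y) \<longleftrightarrow> two_squares ?G x y"
    by (rule graph_auts_reflect[OF assms(2)]) (use xy in \<open>simp_all add: graph_auts_two_squares\<close>)
  moreover have "f x \<in> double_odd_verts k" "f y \<in> double_odd_verts k"
    using graph_auts_in_verts[OF assms(2)] xy by simp_all
  ultimately show ?thesis
    using matching_eq_two_squares[OF assms(1)] xy by simp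
qed

theorem theorem3p4:
  fixes k :: nat
  assumes "k \<ge> 3"
  shows "graph_Aut (extended_double_odd_graph k) = graph_Aut (double_odd_graph k)"
proof -
  let ?L = "extended_double_odd_graph k" and ?G = "double_odd_graph k" and ?V = "double_odd_verts k"
  have k: "k \<ge> 2"
    using assms by simp
  have "graph_auts ?L = graph_auts ?G"
  proof (intro equalityI subsetI)
    fix f assume f: "f \<in> graph_auts ?L"
    have "(f x, f y) \<in> parcs ?G \<longleftrightarrow> (x, y) \<in> parcs ?G" if "x \<in> ?V" "y \<in> ?V" for x y
    proof -
      have fV: "f x \<in> ?V" "f y \<in> ?V"
        using graph_auts_in_verts[OF f] that by simp_all
      show ?thesis
        using graph_auts_arc_iff[OF f, of x y] extended_auts_matched[OF assms f that]
          extended_arc_eq[OF that] extended_arc_eq[OF fV] that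
          double_odd_arc_not_matched[OF k, of x y] double_odd_arc_not_matched[OF k, of "f x" "f y"]
        unfolding pverts_double_odd by blast
    qed
    then show "f \<in> graph_auts ?G"
      using f by (simp add: graph_auts_def)
  next
    fix f assume f: "f \<in> graph_auts ?G"
    have "(f x, f y) \<in> parcs ?L \<longleftrightarrow> (x, y) \<in> parcs ?L" if "x \<in> ?V" "y \<in> ?V" for x y
    proof -
      have fV: "f x \<in> ?V" "f y \<in> ?V"
        using graph_auts_in_verts[OF f] that by simp_all
      show ?thesis
        using graph_auts_arc_iff[OF f, of x y] double_odd_auts_matched[OF k f that]
          extended_arc_eq[OF that] extended_arc_eq[OF fV] that
        by auto
    qed
    then show "f \<in> graph_auts ?L"
      using f by (simp add: graph_auts_def)
  qed
  then show ?thesis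
    by (simp add: graph_Aut_def)
qed

end
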